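(* Let $p$ and $q$ be integers such that $p\le -2$, $q\ge4$ and $q>|p|+1$. For $s\in\{\alpha,\beta\}$ put $$A^{\pm}_s=\sqrt[3]{s^q}\,\frac{\sqrt[3]{s^q F_p}\pm\sqrt[3]{F_{p+q}}}{s^qF_p+F_{p+q}}.$$ Then $$\begin{aligned}\frac{\sqrt5}{\sqrt[3]{F_pF_{p+q}}}\sum_{k = 1}^\infty \Big(\frac{-27F_p F_{p + q}}{F_q^2} \Big)^{k} \frac{F_{(2p + q)k}}{k\binom{3k}{k}} &= 2\sqrt{3}\Bigg(A^{-}_{\alpha} \arctan \bigg( \frac{\sqrt 3\,\sqrt[3]{F_{p + q}}}{2\sqrt[3]{\alpha^q F_p} + \sqrt[3]{F_{p + q}} } \bigg) + A^{-}_{\beta} \arctan \bigg( \frac{\sqrt 3\sqrt[3]{F_p}}{2(-1)^q\sqrt[3]{\alpha^qF_{p+q}} + \sqrt[3]{F_{p}} } \bigg)\Bigg)\\ &\quad -\Bigg( A^{+}_{\alpha}\log\bigg( \frac{\beta^pF_q}{\big(\sqrt[3]{F_{p + q}}- \sqrt[3]{\alpha^q F_p} \big)^3 }\bigg) - A^+_{\beta}\log\bigg( \frac{\alpha^p F_q}{\big(\sqrt[3]{F_{p + q}} - \sqrt[3]{\beta^qF_p}\big)^3} \bigg) \Bigg),\end{aligned}$$ and $$\begin{aligned}\frac{1}{\sqrt[3]{F_pF_{p+q}}}\sum_{k = 1}^\infty \Big(\frac{-27F_p F_{p + q}}{F_q^2} \Big)^{k} \frac{L_{(2p + q)k}}{k\binom{3k}{k}}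 &= 2\sqrt 3\, \Bigg(A^{-}_{\alpha} \arctan \bigg( \frac{\sqrt 3\,\sqrt[3]{F_{p + q}}}{2\sqrt[3]{\alpha^q F_p} + \sqrt[3]{F_{p + q}} } \bigg) -A^{-}_{\beta} \arctan \bigg( \frac{\sqrt 3 \sqrt[3]{F_p}}{2(-1)^q\sqrt[3]{\alpha^qF_{p+q}} + \sqrt[3]{F_{p}} } \bigg) \Bigg)\\ &\quad - \Bigg( A^{+}_{\alpha}\log\bigg( \frac{\beta^pF_q}{\big(\sqrt[3]{F_{p + q}}- \sqrt[3]{\alpha^q F_p} \big)^3 }\bigg) + A^+_{\beta}\log\bigg( \frac{\alpha^p F_q}{\big(\sqrt[3]{F_{p + q}} - \sqrt[3]{\beta^qF_p}\big)^3} \bigg) \Bigg).\end{aligned}$$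
   Context: $F_n$ and $L_n$ are the Fibonacci and Lucas numbers, defined by $F_0=0$, $F_1=1$, $L_0=2$, $L_1=1$, $X_n=X_{n-1}+X_{n-2}$, and extended to negative indices by $F_{-j}=(-1)^{j-1}F_j$, $L_{-j}=(-1)^jL_j$. $\alpha=(1+\sqrt5)/2$, $\beta=(1-\sqrt5)/2$. $\sqrt[3]{t}$ denotes the real cube root (negative for $t<0$). *)

theory Defs
  imports Complex_Main
begin

fun fibn :: "nat \<Rightarrow> int" where
  "fibn 0 = 0"
| "fibn (Suc 0) = 1"
| "fibn (Suc (Suc n)) = fibn (Suc n) + fibn n"

fun lucn :: "nat \<Rightarrow> int" where
  "lucn 0 = 2"
| "lucn (Suc 0) = 1"
| "lucn (Suc (Suc n)) = lucn (Suc n) + lucn n"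

definition Fib :: "int \<Rightarrow> real" where
  "Fib n = (if n \<ge> 0 then real_of_int (fibn (nat n))
            else (-1) ^ (nat (-n) - 1) * real_of_int (fibn (nat (-n))))"

definition Luc :: "int \<Rightarrow> real" where
  "Luc n = (if n \<ge> 0 then real_of_int (lucn (nat n))
            else (-1) ^ (nat (-n)) * real_of_int (lucn (nat (-n))))"

definition alpha :: real where "alpha = (1 + sqrt 5) / 2"
definition beta :: real where "beta = (1 - sqrt 5) / 2"

text \<open>Real cube root (negative for negative arguments); Isabelle's root 3 is odd-extended.\<close>
abbreviation cbrt :: "real \<Rightarrow> real" where "cbrt x \<equiv> root 3 x"

definition Aplus :: "int \<Rightarrow> int \<Rightarrow> real \<Rightarrow> real" where
  "Aplus p q s = cbrt (s powi q) * (cbrt (s powi q * Fib p) + cbrt (Fib (p + q)))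
                 / (s powi q * Fib p + Fib (p + q))"

definition Aminus :: "int \<Rightarrow> int \<Rightarrow> real \<Rightarrow> real" where
  "Aminus p q s = cbrt (s powi q) * (cbrt (s powi q * Fib p) - cbrt (Fib (p + q)))
                 / (s powi q * Fib p + Fib (p + q))"

end

theory Submission
  imports Defs "HOL-Analysis.Analysis"
begin

text \<open>
  Since 1 / (k * binomial(3k, k)) is the Beta integral of t^(k-1) (1-t)^(2k) over [0, 1], the series with
  general term x^k / (k * binomial(3k, k)) equals the integral of x (1-t)^2 / (1 - x t (1-t)^2) for |x| < 27/4.
  The substitution x = -27 r^3 / (1 - r^3)^2 makes the denominator reducible, with the root
  t = -(1-r)^2 / (3r), so that for -1 < r < 1 the integral is elementary.  By Binet's formula the Fibonacci and
  Lucas series are the difference and the sum of two such series, with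
  r^3 = F_(p+q) / (alpha^q F_p) and r^3 = beta^q F_p / F_(p+q); in both cases -1 < r^3 < 1/6, which
  guarantees |x| < 27/4.
\<close>

section \<open>Beta integrals and the series with inverse binomial coefficients\<close>

lemma has_integral_Beta_nat:
  fixes m n :: nat
  shows "((\<lambda>t::real. t ^ m * (1 - t) ^ n) has_integral (fact m * fact n / fact (m + n + 1))) {0..1}"
proof -
  have "((\<lambda>t::real. t powr (real m + 1 - 1) * (1 - t) powr (real n + 1 - 1)) has_integral
          Beta (real m + 1) (real n + 1)) {0..1}"
    by (rule has_integral_Beta_real) auto
  moreover have "Beta (real m + 1) (real n + 1) = fact m * fact n / fact (m + n + 1)"
    using Gamma_fact[of m, where ?'a = real] Gamma_fact[of n, where ?'a = real]
      Gamma_fact[of "m + n + 1", where ?'a = real]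
    by (simp add: Beta_def add_ac)
  ultimately have "((\<lambda>t::real. t powr real m * (1 - t) powr real n) has_integral
          (fact m * fact n / fact (m + n + 1))) {0..1}"
    by simp
  \<comment> \<open>\<open>powr\<close> and \<open>^\<close> disagree only at the endpoints, where
    \<open>0 powr 0 = 0\<close> but \<open>0 ^ 0 = 1\<close>.\<close>
  then show ?thesis
    by (rule has_integral_spike_finite[where S = "{0, 1}", rotated 2])
      (auto simp: powr_realpow)
qed

text \<open>The left side is the Beta integral with exponents \<open>k\<close> and
  \<open>2 * k + 2\<close>: the series starts at 1, so its index is k + 1.\<close>

lemma fact_quotient_eq_inverse_choose:
  "fact k * fact (2 * k + 2) / fact (k + (2 * k + 2) + 1) =
     1 / (real (k + 1) * real ((3 * (k + 1)) choose (k + 1)))"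
proof -
  have "real ((3 * (k + 1)) choose (k + 1)) = fact (3 * (k + 1)) / (fact (k + 1) * fact (3 * (k + 1) - (k + 1)))"
    by (rule binomial_fact) simp
  also have "3 * (k + 1) - (k + 1) = 2 * k + 2" by simp
  finally have "real (k + 1) * real ((3 * (k + 1)) choose (k + 1)) = fact (3 * (k + 1)) / (fact k * fact (2 * k + 2))"
    by (simp only: Suc_eq_plus1[symmetric] fact_Suc) (simp del: of_nat_Suc fact_Suc mult_Suc mult_Suc_right)
  moreover have "k + (2 * k + 2) + 1 = 3 * (k + 1)" by simp
  ultimately show ?thesis by (simp only: divide_divide_eq_right mult_1)
qed

text \<open>The maximum 4/27 is attained at t = 1/3, which is therefore a double root of the
  difference.\<close>

lemma cubic_unit_interval_le:
  fixes t :: real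
  assumes "0 \<le> t" "t \<le> 1"
  shows "t * (1 - t)\<^sup>2 \<le> 4 / 27"
proof -
  have "4 / 27 - t * (1 - t)\<^sup>2 = (4 / 3 - t) * (t - 1 / 3)\<^sup>2"
    by (simp add: field_simps power2_eq_square)
  also have "\<dots> \<ge> 0" using assms by simp
  finally show ?thesis by simp
qed

text \<open>No interchange of sum and integral is needed: the integrand minus its n-th partial
  geometric sum equals \<open>g t * w ^ n\<close> with w = x t (1-t)^2. Since |w| \<le>
  \<open>\<rho>\<close> < 1 uniformly in t, the difference between \<open>J\<close> and the n-th
  partial sum decays geometrically.\<close>

lemma sums_inverse_choose_integral:
  fixes x J :: real
  assumes x: "\<bar>x\<bar> < 27 / 4"
    and J: "((\<lambda>t. x * (1 - t)\<^sup>2 / (1 - x * (t * (1 - t)\<^sup>2))) has_integral J) {0..1}"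
  shows "(\<lambda>k. x ^ (k + 1) / (real (k + 1) * real ((3 * (k + 1)) choose (k + 1)))) sums J"
proof -
  define g where "g t = x * (1 - t)\<^sup>2 / (1 - x * (t * (1 - t)\<^sup>2))" for t
  define c where "c k = x ^ (k + 1) / (real (k + 1) * real ((3 * (k + 1)) choose (k + 1)))" for k
  define \<rho> where "\<rho> = \<bar>x\<bar> * (4 / 27)"
  have \<rho>: "0 \<le> \<rho>" "\<rho> < 1" using x by (auto simp: \<rho>_def)
  have sum_term: "((\<lambda>t. x * (1 - t)\<^sup>2 * (x * (t * (1 - t)\<^sup>2)) ^ k) has_integral c k) {0..1}" for k
  proof -
    have "((\<lambda>t. x ^ (k + 1) * (t ^ k * (1 - t) ^ (2 * k + 2))) has_integral c k) {0..1}"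
      using has_integral_mult_right[OF has_integral_Beta_nat[of k "2 * k + 2"], of "x ^ (k + 1)"]
      unfolding fact_quotient_eq_inverse_choose by (simp add: c_def)
    moreover have "x ^ (k + 1) * (t ^ k * (1 - t) ^ (2 * k + 2)) =
        x * (1 - t)\<^sup>2 * (x * (t * (1 - t)\<^sup>2)) ^ k" for t
      by (simp only: power_mult_distrib power_add power_mult[symmetric] power_one_right mult_ac)
    ultimately show ?thesis by (simp only:)
  qed
  have bound: "norm (J - (\<Sum>k<n. c k)) \<le> \<bar>x\<bar> / (1 - \<rho>) * \<rho> ^ n" for n
  proof -
    have "((\<lambda>t. g t - (\<Sum>k<n. x * (1 - t)\<^sup>2 * (x * (t * (1 - t)\<^sup>2)) ^ k)) has_integral
            (J - (\<Sum>k<n. c k))) (cbox 0 1)"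
      using J sum_term by (auto intro!: has_integral_diff has_integral_sum simp: g_def)
    moreover have "norm (g t - (\<Sum>k<n. x * (1 - t)\<^sup>2 * (x * (t * (1 - t)\<^sup>2)) ^ k))
        \<le> \<bar>x\<bar> / (1 - \<rho>) * \<rho> ^ n" if "t \<in> cbox 0 1" for t
    proof -
      define w where "w = x * (t * (1 - t)\<^sup>2)"
      have t: "0 \<le> t" "t \<le> 1" using that by auto
      have w: "\<bar>w\<bar> \<le> \<rho>"
        using mult_left_mono[OF cubic_unit_interval_le[OF t] abs_ge_zero[of x]] t
        by (simp add: w_def \<rho>_def abs_mult)
      have w1: "1 - \<rho> \<le> 1 - w" "w \<noteq> 1" using w \<rho> by auto
      have "(\<Sum>k<n. x * (1 - t)\<^sup>2 * w ^ k) = x * (1 - t)\<^sup>2 * ((1 - w ^ n) / (1 - w))"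
        unfolding sum_distrib_left[symmetric] sum_gp_strict using w1 by simp
      moreover have "g t = x * (1 - t)\<^sup>2 / (1 - w)" by (simp add: g_def w_def)
      ultimately have "g t - (\<Sum>k<n. x * (1 - t)\<^sup>2 * w ^ k) = x * (1 - t)\<^sup>2 / (1 - w) * w ^ n"
        by (simp add: right_diff_distrib diff_divide_distrib)
      also have "norm \<dots> = \<bar>x\<bar> * (1 - t)\<^sup>2 / (1 - w) * \<bar>w\<bar> ^ n"
        using w1 \<rho> by (simp add: abs_mult power_abs)
      also have "\<dots> \<le> \<bar>x\<bar> / (1 - \<rho>) * \<rho> ^ n"
      proof (intro mult_mono frac_le power_mono w)
        have "(1 - t)\<^sup>2 \<le> 1" using t by (simp add: power_le_one)
        then show "\<bar>x\<bar> * (1 - t)\<^sup>2 \<le> \<bar>x\<bar>" by (simp add: mult_left_le)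
      qed (use w1 \<rho> in auto)
      finally show ?thesis by (simp add: w_def)
    qed
    moreover have "0 \<le> \<bar>x\<bar> / (1 - \<rho>) * \<rho> ^ n" using \<rho> by simp
    ultimately have "norm (J - (\<Sum>k<n. c k)) \<le> \<bar>x\<bar> / (1 - \<rho>) * \<rho> ^ n * measure lborel (cbox 0 (1::real))"
      by (intro has_integral_bound)
    then show ?thesis by simp
  qed
  have "(\<lambda>n. \<bar>x\<bar> / (1 - \<rho>) * \<rho> ^ n) \<longlonglongrightarrow> 0"
    using tendsto_mult_left[OF LIMSEQ_power_zero[of \<rho>], of "\<bar>x\<bar> / (1 - \<rho>)"] \<rho>
    by (simp only: mult_zero_right real_norm_def abs_of_nonneg)
  then have "(\<lambda>n. J - (\<Sum>k<n. c k)) \<longlonglongrightarrow> 0"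
    by (rule Lim_null_comparison[rotated]) (intro always_eventually allI bound)
  then have "(\<lambda>n. \<Sum>k<n. c k) \<longlonglongrightarrow> J"
    using tendsto_diff[OF tendsto_const[of J], of "\<lambda>n. J - (\<Sum>k<n. c k)" 0] by simp
  then show ?thesis by (simp add: sums_def c_def)
qed

section \<open>Arctangent identities by differentiation\<close>

lemma quadratic_trinomial_pos:
  fixes x :: real
  shows "1 + x + x\<^sup>2 > 0" "1 - x + x\<^sup>2 > 0"
proof -
  have "1 + x + x\<^sup>2 = (x + 1 / 2)\<^sup>2 + 3 / 4" "1 - x + x\<^sup>2 = (x - 1 / 2)\<^sup>2 + 3 / 4"
    by (simp_all add: power2_eq_square field_simps)
  then show "1 + x + x\<^sup>2 > 0" "1 - x + x\<^sup>2 > 0"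
    by (simp_all add: add_nonneg_pos)
qed

text \<open>Serves to prove arctangent identities by comparing derivatives and values at 0, which
  avoids the branch conditions of the addition formula.\<close>

lemma has_real_derivative_zero_eq_on_unit_ball:
  fixes f :: "real \<Rightarrow> real"
  assumes "\<And>x. -1 < x \<Longrightarrow> x < 1 \<Longrightarrow> (f has_real_derivative 0) (at x)" and "-1 < r" "r < 1"
  shows "f r = f 0"
proof -
  have "\<exists>c. \<forall>x\<in>{-1<..<1}. f x = c"
    by (rule has_field_derivative_zero_constant)
      (auto intro: has_field_derivative_at_within[OF assms(1)])
  then show ?thesis using assms(2,3) by force
qed

text \<open>Clearing \<open>g x\<close> from the quotient rule leaves a sum of two squares, which
  simplifies in each application.\<close>

lemma has_real_derivative_arctan_divide:
  fixes f g :: "real \<Rightarrow> real"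
  assumes "(f has_real_derivative f') (at x)" and "(g has_real_derivative g') (at x)" and "g x \<noteq> 0"
  shows "((\<lambda>x. arctan (f x / g x)) has_real_derivative
           (f' * g x - f x * g') / ((f x)\<^sup>2 + (g x)\<^sup>2)) (at x)"
proof -
  have "((\<lambda>x. arctan (f x / g x)) has_real_derivative
           inverse (1 + (f x / g x)\<^sup>2) * ((f' * g x - f x * g') / (g x * g x))) (at x)"
    by (rule DERIV_chain2[OF DERIV_arctan DERIV_divide[OF assms]])
  also have "1 + (f x / g x)\<^sup>2 = ((f x)\<^sup>2 + (g x)\<^sup>2) / (g x * g x)"
    using assms(3) by (simp add: power_divide field_simps power2_eq_square)
  finally show ?thesis using assms(3) by simp
qed

lemma arctan_inverse_sqrt_3: "arctan (1 / sqrt 3) = pi / 6"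
  using arctan_unique[of "pi / 6" "1 / sqrt 3"] tan_30 by simp

text \<open>This arctangent is the one in the closed form. Those in the next two lemmas have the
  same derivative up to a constant factor.\<close>

lemma has_real_derivative_arctan_sqrt_3:
  fixes x :: real
  assumes "-1 < x"
  shows "((\<lambda>x. arctan (sqrt 3 * x / (2 + x))) has_real_derivative sqrt 3 / (2 * (1 + x + x\<^sup>2))) (at x)"
proof -
  define E where "E = 1 + x + x\<^sup>2"
  have "((\<lambda>x. arctan (sqrt 3 * x / (2 + x))) has_real_derivative
      (sqrt 3 * (2 + x) - sqrt 3 * x * 1) / ((sqrt 3 * x)\<^sup>2 + (2 + x)\<^sup>2)) (at x)"
    using assms by (intro has_real_derivative_arctan_divide) (auto intro!: derivative_eq_intros)
  also have "sqrt 3 * (2 + x) - sqrt 3 * x * 1 = 2 * sqrt 3"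
    by (simp add: algebra_simps)
  also have "(sqrt 3 * x)\<^sup>2 + (2 + x)\<^sup>2 = 2 * (2 * E)"
    by (simp add: E_def power_mult_distrib) (simp add: power2_eq_square algebra_simps)
  finally show ?thesis unfolding E_def[symmetric] by simp
qed

text \<open>Both sides have the same derivative and agree at 0. Up to sign, the left side is the
  arctangent of the antiderivative below at t = 1.\<close>

lemma arctan_shift_once:
  fixes r :: real
  assumes r: "-1 < r" "r < 1"
  shows "arctan ((1 - r) / (sqrt 3 * (1 + r))) = pi / 6 - arctan (sqrt 3 * r / (2 + r))"
proof -
  define f where "f x = arctan ((1 - x) / (sqrt 3 * (1 + x))) + arctan (sqrt 3 * x / (2 + x))" for x :: real
  have "f r = f 0"
  proof (rule has_real_derivative_zero_eq_on_unit_ball[OF _ r])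
    fix x :: real assume x: "-1 < x" "x < 1"
    define E where "E = 1 + x + x\<^sup>2"
    have "((\<lambda>x. arctan ((1 - x) / (sqrt 3 * (1 + x)))) has_real_derivative
        (- 1 * (sqrt 3 * (1 + x)) - (1 - x) * sqrt 3) / ((1 - x)\<^sup>2 + (sqrt 3 * (1 + x))\<^sup>2)) (at x)"
      using x by (intro has_real_derivative_arctan_divide) (auto intro!: derivative_eq_intros)
    also have "- 1 * (sqrt 3 * (1 + x)) - (1 - x) * sqrt 3 = 2 * (- sqrt 3)"
      by (simp add: algebra_simps)
    also have "(1 - x)\<^sup>2 + (sqrt 3 * (1 + x))\<^sup>2 = 2 * (2 * E)"
      by (simp add: E_def power_mult_distrib) (simp add: power2_eq_square algebra_simps)
    finally have "(f has_real_derivative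
        2 * (- sqrt 3) / (2 * (2 * E)) + sqrt 3 / (2 * E)) (at x)"
      unfolding f_def E_def by (rule DERIV_add[OF _ has_real_derivative_arctan_sqrt_3[OF x(1)]])
    then show "(f has_real_derivative 0) (at x)" by simp
  qed
  then show ?thesis by (simp add: f_def arctan_inverse_sqrt_3)
qed

text \<open>Proved in the same way; up to sign, the left side is the arctangent of the
  antiderivative below at t = 0.\<close>

lemma arctan_shift_twice:
  fixes r :: real
  assumes r: "-1 < r" "r < 1"
  shows "arctan ((1 + 4 * r + r\<^sup>2) / (sqrt 3 * (1 - r\<^sup>2))) = pi / 6 + 2 * arctan (sqrt 3 * r / (2 + r))"
proof -
  define f where "f x = arctan ((1 + 4 * x + x\<^sup>2) / (sqrt 3 * (1 - x\<^sup>2))) - 2 * arctan (sqrt 3 * x / (2 + x))" for x :: real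
  have "f r = f 0"
  proof (rule has_real_derivative_zero_eq_on_unit_ball[OF _ r])
    fix x :: real assume x: "-1 < x" "x < 1"
    define E where "E = 1 + x + x\<^sup>2"
    have E: "E > 0" by (simp add: E_def quadratic_trinomial_pos)
    have x2: "x\<^sup>2 < 1" using x by (simp add: abs_square_less_1)
    have "((\<lambda>x. arctan ((1 + 4 * x + x\<^sup>2) / (sqrt 3 * (1 - x\<^sup>2)))) has_real_derivative
        ((4 + 2 * x) * (sqrt 3 * (1 - x\<^sup>2)) - (1 + 4 * x + x\<^sup>2) * (sqrt 3 * (- 2 * x)))
          / ((1 + 4 * x + x\<^sup>2)\<^sup>2 + (sqrt 3 * (1 - x\<^sup>2))\<^sup>2)) (at x)"
      using x2 by (intro has_real_derivative_arctan_divide) (auto intro!: derivative_eq_intros)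
    also have "(4 + 2 * x) * (sqrt 3 * (1 - x\<^sup>2)) - (1 + 4 * x + x\<^sup>2) * (sqrt 3 * (- 2 * x)) = 4 * sqrt 3 * E"
      by (simp add: E_def algebra_simps power2_eq_square)
    also have "(1 + 4 * x + x\<^sup>2)\<^sup>2 + (sqrt 3 * (1 - x\<^sup>2))\<^sup>2 = 4 * E\<^sup>2"
      by (simp add: power_mult_distrib) (simp add: E_def power2_eq_square algebra_simps)
    finally have "(f has_real_derivative 4 * sqrt 3 * E / (4 * E\<^sup>2) - 2 * (sqrt 3 / (2 * E))) (at x)"
      unfolding f_def E_def
      by (rule DERIV_diff[OF _ DERIV_cmult[OF has_real_derivative_arctan_sqrt_3[OF x(1)]]])
    then show "(f has_real_derivative 0) (at x)" using E by (simp add: power2_eq_square)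
  qed
  then show ?thesis by (simp add: f_def arctan_inverse_sqrt_3)
qed

section \<open>The integral in closed form\<close>

text \<open>Partial fractions: multiplied by (1 - r^3)^2, the denominator factors into a linear
  \<open>P\<close> and a positive quadratic \<open>Q\<close>, and \<open>\<Phi>\<close> is the
  resulting antiderivative.\<close>

lemma cubic_has_integral:
  fixes r :: real
  assumes r: "-1 < r" "r < 1"
  defines "x \<equiv> - 27 * r ^ 3 / (1 - r ^ 3)\<^sup>2"
  shows "((\<lambda>t. x * (1 - t)\<^sup>2 / (1 - x * (t * (1 - t)\<^sup>2))) has_integral
     (2 * sqrt 3 * (r * (1 - r) / (1 + r ^ 3)) * arctan (sqrt 3 * r / (2 + r))
       - r * (1 + r) / (1 + r ^ 3) * ln ((1 - r ^ 3) / (1 - r) ^ 3))) {0..1}"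
proof -
  define E where "E = 1 - r + r\<^sup>2"
  define V where "V = (1 - r)\<^sup>2"
  define W where "W = 1 + r + r\<^sup>2"
  have E: "E > 0" unfolding E_def by (rule quadratic_trinomial_pos)
  have W: "W > 0" unfolding W_def by (rule quadratic_trinomial_pos)
  have V: "V > 0" using r by (simp add: V_def)
  have r2: "1 - r\<^sup>2 > 0" using r by (simp add: abs_square_less_1)
  have r3p: "1 + r ^ 3 = (1 + r) * E" and r3m: "1 - r ^ 3 = (1 - r) * W"
    by (simp_all add: E_def W_def power2_eq_square power3_eq_cube algebra_simps)
  \<comment> \<open>Since x depends on r only through r^3, for r \<noteq> 0 the other roots of the
    denominator come from t = -(1-r)^2 / (3r) on multiplying r by a primitive cube root of unity.
    \<open>Q\<close> is the product of these two conjugate factors, with the square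
    completed.\<close>
  define P where "P t = 3 * r * t + V" for t
  define Q where "Q t = (3 * r * t - (1 + 4 * r + r\<^sup>2) / 2)\<^sup>2 + 3 / 4 * (1 - r\<^sup>2)\<^sup>2" for t
  \<comment> \<open>For r \<noteq> 0, \<open>A\<close> is the residue at the zero of
    \<open>P\<close>, and \<open>A + B = -1\<close> because the integrand behaves like -1/t at
    infinity. \<open>D\<close> lets the arctangent supply the constant left in the numerator over
    \<open>Q\<close>.\<close>
  define A where "A = - W / (3 * E)"
  define B where "B = - 1 - A"
  define D where "D = 2 / sqrt 3 * (r * (1 - r) / ((1 + r) * E))"
  define \<Phi> where "\<Phi> t = A * ln (P t) + B / 2 * ln (Q t) +
    D * arctan ((6 * r * t - (1 + 4 * r + r\<^sup>2)) / (sqrt 3 * (1 - r\<^sup>2)))" for t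
  have Q: "Q t > 0" for t
    using r2 by (simp add: Q_def add_nonneg_pos)
  have PQ: "(1 - r ^ 3)\<^sup>2 + 27 * r ^ 3 * (t * (1 - t)\<^sup>2) = P t * Q t" for t
    by (simp add: P_def Q_def V_def field_simps power2_eq_square power3_eq_cube)
  have deriv: "(\<Phi> has_real_derivative x * (1 - t)\<^sup>2 / (1 - x * (t * (1 - t)\<^sup>2))) (at t)"
    if t: "0 \<le> t" "t \<le> 1" for t
  proof -
    \<comment> \<open>A convex combination of the positive endpoint values of
      \<open>P\<close>.\<close>
    have "P t = (1 - t) * V + t * W"
      by (simp add: P_def V_def W_def power2_eq_square algebra_simps)
    then have P: "P t > 0"
      using t V W by (cases "t = 0") (auto intro!: add_nonneg_pos)
    have "((\<lambda>t. arctan ((6 * r * t - (1 + 4 * r + r\<^sup>2)) / (sqrt 3 * (1 - r\<^sup>2)))) has_real_derivative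
        (6 * r * (sqrt 3 * (1 - r\<^sup>2)) - (6 * r * t - (1 + 4 * r + r\<^sup>2)) * 0)
          / ((6 * r * t - (1 + 4 * r + r\<^sup>2))\<^sup>2 + (sqrt 3 * (1 - r\<^sup>2))\<^sup>2)) (at t)"
      using r2 by (intro has_real_derivative_arctan_divide) (auto intro!: derivative_eq_intros)
    also have "(6 * r * t - (1 + 4 * r + r\<^sup>2))\<^sup>2 + (sqrt 3 * (1 - r\<^sup>2))\<^sup>2 = 4 * Q t"
      by (simp add: power_mult_distrib Q_def) (simp add: power2_eq_square field_simps)
    finally have arctan_deriv: "((\<lambda>t. arctan ((6 * r * t - (1 + 4 * r + r\<^sup>2)) / (sqrt 3 * (1 - r\<^sup>2))))
        has_real_derivative 6 * r * (sqrt 3 * (1 - r\<^sup>2)) / (4 * Q t)) (at t)"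
      by simp
    have P_deriv: "((\<lambda>t. ln (P t)) has_real_derivative 3 * r / P t) (at t)"
      using P unfolding P_def by (auto intro!: derivative_eq_intros)
    have Q_deriv: "((\<lambda>t. ln (Q t)) has_real_derivative
        2 * (3 * r * t - (1 + 4 * r + r\<^sup>2) / 2) * (3 * r) / Q t) (at t)"
      using Q[of t] unfolding Q_def by (auto intro!: derivative_eq_intros)
    have "(\<Phi> has_real_derivative A * (3 * r / P t) +
        B / 2 * (2 * (3 * r * t - (1 + 4 * r + r\<^sup>2) / 2) * (3 * r) / Q t) +
        D * (6 * r * (sqrt 3 * (1 - r\<^sup>2)) / (4 * Q t))) (at t)"
      unfolding \<Phi>_def by (intro DERIV_add DERIV_cmult P_deriv Q_deriv arctan_deriv)
    also have "D * (6 * r * (sqrt 3 * (1 - r\<^sup>2)) / (4 * Q t)) = 3 * r\<^sup>2 * V / E / Q t"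
    proof -
      have "2 / sqrt 3 * (K / G) * (6 * r * (sqrt 3 * M) / (4 * q)) = 3 * (r * K * M) / G / q"
        for K G M q :: real by simp
      then have "D * (6 * r * (sqrt 3 * (1 - r\<^sup>2)) / (4 * Q t)) =
          3 * (r * (r * (1 - r)) * (1 - r\<^sup>2)) / ((1 + r) * E) / Q t"
        unfolding D_def .
      also have "3 * (r * (r * (1 - r)) * (1 - r\<^sup>2)) =
          3 * r\<^sup>2 * (1 - r) * ((1 - r) * (1 + r))"
        by (simp add: power2_eq_square algebra_simps)
      also have "3 * r\<^sup>2 * (1 - r) * ((1 - r) * (1 + r)) / ((1 + r) * E) = 3 * r\<^sup>2 * V / E"
        using r by (simp add: V_def power2_eq_square)
      finally show ?thesis .
    qed
    also have "A * (3 * r / P t) + B / 2 * (2 * (3 * r * t - (1 + 4 * r + r\<^sup>2) / 2) * (3 * r) / Q t)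
        + 3 * r\<^sup>2 * V / E / Q t = - 27 * r ^ 3 * (1 - t)\<^sup>2 / (P t * Q t)"
    proof -
      define N where "N = 3 * r * t - (1 + 4 * r + r\<^sup>2) / 2"
      define Z where "Z = A * (3 * r) * Q t + B * (N * (3 * r)) * P t + 3 * r\<^sup>2 * V / E * P t"
      have "A * (3 * r / p) + B / 2 * (2 * N * (3 * r) / q) + 3 * r\<^sup>2 * V / E / q =
          (A * (3 * r) * q + B * (N * (3 * r)) * p + 3 * r\<^sup>2 * V / E * p) / (p * q)"
        if "p > 0" "q > 0" for p q
        using that by (simp add: add_divide_distrib mult_ac)
      from this[OF P Q] have "A * (3 * r / P t) + B / 2 * (2 * N * (3 * r) / Q t) + 3 * r\<^sup>2 * V / E / Q t =
          Z / (P t * Q t)"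
        by (simp only: Z_def)
      \<comment> \<open>The factor \<open>3 * E\<close> clears the denominators of \<open>A\<close>,
        \<open>B\<close> and \<open>V / E\<close>, so that a polynomial identity remains.\<close>
      moreover have "3 * E * Z = 3 * E * (- 27 * r ^ 3 * (1 - t)\<^sup>2)"
      proof -
        have "3 * E * A = - W" "3 * E * B = W - 3 * E" "E * (V / E) = V"
          using E by (auto simp: A_def B_def field_simps)
        moreover have "3 * E * Z = (3 * E * A) * (3 * r) * Q t + (3 * E * B) * (N * (3 * r)) * P t
            + 9 * r\<^sup>2 * (E * (V / E)) * P t"
          by (simp add: Z_def distrib_left mult_ac)
        ultimately have "3 * E * Z = - W * (3 * r) * Q t + (W - 3 * E) * (N * (3 * r)) * P t + 9 * r\<^sup>2 * V * P t"
          by (simp only:)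
        also have "\<dots> = 3 * E * (- 27 * r ^ 3 * (1 - t)\<^sup>2)"
          by (simp add: W_def E_def P_def Q_def V_def N_def field_simps power2_eq_square power3_eq_cube)
        finally show ?thesis .
      qed
      then have "Z = - 27 * r ^ 3 * (1 - t)\<^sup>2"
        using E by (subst (asm) mult_cancel_left) simp
      ultimately show ?thesis by (simp only: N_def)
    qed
    also have "\<dots> = x * (1 - t)\<^sup>2 / (1 - x * (t * (1 - t)\<^sup>2))"
    proof -
      have "(1 - r ^ 3)\<^sup>2 \<noteq> 0" using r W by (simp add: r3m)
      then have "1 - x * (t * (1 - t)\<^sup>2) = P t * Q t / (1 - r ^ 3)\<^sup>2"
        unfolding PQ[symmetric] x_def by (simp add: add_divide_distrib)
      then show ?thesis using \<open>(1 - r ^ 3)\<^sup>2 \<noteq> 0\<close> by (simp add: x_def)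
    qed
    finally show ?thesis .
  qed
  have "((\<lambda>t. x * (1 - t)\<^sup>2 / (1 - x * (t * (1 - t)\<^sup>2))) has_integral (\<Phi> 1 - \<Phi> 0)) {0..1}"
  proof (rule fundamental_theorem_of_calculus[where f = \<Phi>])
    fix t :: real assume "t \<in> {0..1}"
    then have "(\<Phi> has_real_derivative x * (1 - t)\<^sup>2 / (1 - x * (t * (1 - t)\<^sup>2))) (at t within {0..1})"
      by (intro has_field_derivative_at_within[OF deriv]) auto
    then show "(\<Phi> has_vector_derivative x * (1 - t)\<^sup>2 / (1 - x * (t * (1 - t)\<^sup>2))) (at t within {0..1})"
      by (simp only: has_real_derivative_iff_has_vector_derivative)
  qed simp
  moreover have "\<Phi> 1 - \<Phi> 0 =
     2 * sqrt 3 * (r * (1 - r) / (1 + r ^ 3)) * arctan (sqrt 3 * r / (2 + r))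
       - r * (1 + r) / (1 + r ^ 3) * ln ((1 - r ^ 3) / (1 - r) ^ 3)"
  proof -
    \<comment> \<open>With these values all logarithms combine into a multiple of
      \<open>ln W - ln V\<close>. The two shifts by pi/6 cancel, and the arctangent is counted 1 + 2
      = 3 times.\<close>
    have "P 1 = W" "Q 1 = V * W" "P 0 = V" "Q 0 = W\<^sup>2"
      by (simp_all add: P_def Q_def V_def W_def field_simps power2_eq_square)
    moreover have "(6 * r * 1 - (1 + 4 * r + r\<^sup>2)) / (sqrt 3 * (1 - r\<^sup>2)) = - ((1 - r) / (sqrt 3 * (1 + r)))"
    proof -
      have "6 * r * 1 - (1 + 4 * r + r\<^sup>2) = - ((1 - r) * (1 - r))" "1 - r\<^sup>2 = (1 - r) * (1 + r)"
        by (simp_all add: power2_eq_square algebra_simps)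
      then show ?thesis using r by simp
    qed
    moreover have "(6 * r * 0 - (1 + 4 * r + r\<^sup>2)) / (sqrt 3 * (1 - r\<^sup>2)) = - ((1 + 4 * r + r\<^sup>2) / (sqrt 3 * (1 - r\<^sup>2)))"
      by (simp only: minus_divide_left) simp
    ultimately have "\<Phi> 1 - \<Phi> 0 = (A - B / 2) * (ln W - ln V) + 3 * D * arctan (sqrt 3 * r / (2 + r))"
      using V W unfolding \<Phi>_def
      by (simp only: arctan_minus arctan_shift_once[OF r] arctan_shift_twice[OF r])
        (simp add: ln_mult ln_realpow field_simps)
    also have "A - B / 2 = - (r * (1 + r) / (1 + r ^ 3))"
    proof -
      have "A - B / 2 = (3 * E - 3 * W) / (6 * E)"
        using E by (simp add: A_def B_def field_simps)
      also have "3 * E - 3 * W = - 6 * r" by (simp add: E_def W_def)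
      finally show ?thesis using r E by (simp add: r3p divide_simps)
    qed
    also have "ln W - ln V = ln ((1 - r ^ 3) / (1 - r) ^ 3)"
    proof -
      have "(1 - r ^ 3) / (1 - r) ^ 3 = W / V"
        unfolding r3m using r by (simp add: V_def power2_eq_square power3_eq_cube)
      then show ?thesis using V W by (simp add: ln_div)
    qed
    also have "3 * D = 2 * sqrt 3 * (r * (1 - r) / (1 + r ^ 3))"
    proof -
      have "3 * (2 / sqrt 3) = 2 * sqrt (3 :: real)" by (simp add: divide_eq_eq mult.assoc)
      then show ?thesis unfolding D_def r3p by (simp only: mult.assoc[symmetric])
    qed
    finally show ?thesis by simp
  qed
  ultimately show ?thesis by simp
qed

text \<open>Homogeneous form of the evaluation, with r = u/v: the coefficients and arguments all
  have degree zero in \<open>u\<close> and \<open>v\<close>, so cube roots can be inserted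
  directly.\<close>

lemma sums_inverse_choose_cubes:
  fixes u v :: real
  assumes nz: "u \<noteq> 0" "v \<noteq> 0" and lower: "-1 < u ^ 3 / v ^ 3" and upper: "u ^ 3 / v ^ 3 < 1 / 6"
  shows "(\<lambda>k. (- 27 * u ^ 3 * v ^ 3 / (v ^ 3 - u ^ 3)\<^sup>2) ^ (k + 1) /
             (real (k + 1) * real ((3 * (k + 1)) choose (k + 1)))) sums
           (2 * sqrt 3 * (u * v * (v - u) / (u ^ 3 + v ^ 3)) * arctan (sqrt 3 * u / (2 * v + u))
             - u * v * (u + v) / (u ^ 3 + v ^ 3) * ln ((v ^ 3 - u ^ 3) / (v - u) ^ 3))"
proof -
  define r where "r = u / v"
  have u: "u = r * v" using nz by (simp add: r_def)
  define a where "a = r ^ 3"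
  have a: "-1 < a" "a < 1 / 6" using lower upper by (simp_all add: a_def r_def power_divide)
  have r: "-1 < r" "r < 1"
  proof -
    show "-1 < r"
      using power_mono_odd[of 3 r "-1"] a(1) by (force simp: a_def)
    show "r < 1"
    proof (rule ccontr)
      assume "\<not> r < 1"
      then have "r ^ 3 \<ge> 1" by (simp add: one_le_power)
      then show False using a(2) by (simp add: a_def)
    qed
  qed
  have "\<bar>- 27 * a / (1 - a)\<^sup>2\<bar> < 27 / 4"
  proof -
    \<comment> \<open>Equivalent to |x| < 27/4. For negative \<open>a\<close> it says (1 + a)^2 > 0,
      for the others 1 - 6a + a^2 > 0.\<close>
    have "4 * \<bar>a\<bar> < (1 - a)\<^sup>2"
    proof (cases "a < 0")
      case True
      have "0 < (1 + a)\<^sup>2" using a(1) by simp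
      then show ?thesis using True by (simp add: power2_eq_square algebra_simps)
    next
      case False
      \<comment> \<open>1/6 and 35/6 have sum 6 and product 35/36 < 1, so this product lies just
        below 1 - 6a + a^2.\<close>
      have "0 < (1 / 6 - a) * (35 / 6 - a)" using a by (intro mult_pos_pos) auto
      also have "\<dots> < 1 - 6 * a + a\<^sup>2" using a by (simp add: power2_eq_square field_simps)
      finally show ?thesis using False by (simp add: power2_eq_square algebra_simps)
    qed
    then show ?thesis using a by (simp add: abs_mult divide_simps)
  qed
  then have "(\<lambda>k. (- 27 * r ^ 3 / (1 - r ^ 3)\<^sup>2) ^ (k + 1) /
             (real (k + 1) * real ((3 * (k + 1)) choose (k + 1)))) sums
       (2 * sqrt 3 * (r * (1 - r) / (1 + r ^ 3)) * arctan (sqrt 3 * r / (2 + r))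
       - r * (1 + r) / (1 + r ^ 3) * ln ((1 - r ^ 3) / (1 - r) ^ 3))"
    unfolding a_def by (intro sums_inverse_choose_integral cubic_has_integral r)
  moreover have "v ^ 3 - u ^ 3 = v ^ 3 * (1 - r ^ 3)" "u ^ 3 + v ^ 3 = v ^ 3 * (1 + r ^ 3)"
      "v - u = v * (1 - r)" "u + v = v * (1 + r)" "2 * v + u = v * (2 + r)"
    by (simp_all add: u power_mult_distrib algebra_simps)
  moreover have "- 27 * u ^ 3 * v ^ 3 / (v ^ 3 * (1 - r ^ 3))\<^sup>2 = - 27 * r ^ 3 / (1 - r ^ 3)\<^sup>2"
    using nz by (simp add: u power_mult_distrib power2_eq_square)
  moreover have "u * v * (v * (1 - r)) / (v ^ 3 * (1 + r ^ 3)) = r * (1 - r) / (1 + r ^ 3)"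
      "u * v * (v * (1 + r)) / (v ^ 3 * (1 + r ^ 3)) = r * (1 + r) / (1 + r ^ 3)"
    using nz by (simp_all add: u power3_eq_cube)
  moreover have "sqrt 3 * u / (v * (2 + r)) = sqrt 3 * r / (2 + r)"
    using nz by (simp add: u)
  moreover have "v ^ 3 * (1 - r ^ 3) / (v * (1 - r)) ^ 3 = (1 - r ^ 3) / (1 - r) ^ 3"
    using nz by (simp add: power_mult_distrib)
  ultimately show ?thesis by (simp only:)
qed

section \<open>The golden ratio and Binet's formulas at integer indices\<close>

lemma sqrt_5_bounds: "2.2 < sqrt 5" "sqrt 5 < 3"
  by (rule real_less_rsqrt real_less_lsqrt; simp add: power2_eq_square)+

lemma alpha_gt: "alpha > 1.6" using sqrt_5_bounds by (simp add: alpha_def)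

lemma beta_less_0: "beta < 0" using sqrt_5_bounds by (simp add: beta_def)

lemma alpha_square: "alpha\<^sup>2 = alpha + 1"
  by (simp add: alpha_def power2_eq_square field_simps)

lemma beta_square: "beta\<^sup>2 = beta + 1"
  by (simp add: beta_def power2_eq_square field_simps)

lemma alpha_mult_beta: "alpha * beta = -1"
  by (simp add: alpha_def beta_def field_simps)

lemma alpha_minus_beta: "alpha - beta = sqrt 5"
  by (simp add: alpha_def beta_def field_simps)

lemma alpha_plus_beta: "alpha + beta = 1"
  by (simp add: alpha_def beta_def field_simps)

lemma power_recurrence:
  fixes x :: real
  assumes "x\<^sup>2 = x + 1"
  shows "x ^ Suc (Suc n) = x ^ Suc n + x ^ n"
proof -
  have "x ^ Suc (Suc n) = x ^ n * x\<^sup>2" by (simp add: power2_eq_square)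
  then show ?thesis by (simp add: assms algebra_simps)
qed

lemma fibn_binet: "sqrt 5 * real_of_int (fibn n) = alpha ^ n - beta ^ n"
proof (induction n rule: fibn.induct)
  case (3 n)
  then show ?case
    unfolding power_recurrence[OF alpha_square] power_recurrence[OF beta_square]
    by (simp add: distrib_left)
qed (simp_all add: alpha_minus_beta)

lemma lucn_binet: "real_of_int (lucn n) = alpha ^ n + beta ^ n"
proof (induction n rule: lucn.induct)
  case (3 n)
  then show ?case
    unfolding power_recurrence[OF alpha_square] power_recurrence[OF beta_square]
    by simp
qed (simp_all add: alpha_plus_beta)

text \<open>Since \<open>alpha * beta = -1\<close>, inversion exchanges the two numbers up to sign;
  this reduces Binet's formulas at negative indices to natural exponents.\<close>

lemma powi_minus_conjugate:
  "alpha powi (- int n) = (-1) ^ n * beta ^ n" "beta powi (- int n) = (-1) ^ n * alpha ^ n"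
proof -
  have "inverse alpha = - 1 * beta" "inverse beta = - 1 * alpha"
    using alpha_mult_beta by (auto intro!: inverse_unique simp: mult.commute)
  then show "alpha powi (- int n) = (-1) ^ n * beta ^ n" "beta powi (- int n) = (-1) ^ n * alpha ^ n"
    by (simp_all only: power_int_minus power_int_of_nat power_inverse[symmetric] power_mult_distrib[symmetric])
qed

lemma Fib_binet: "sqrt 5 * Fib n = alpha powi n - beta powi n"
proof (cases "n \<ge> 0")
  case True
  then show ?thesis
    using fibn_binet[of "nat n"] by (simp add: Fib_def power_int_def)
next
  case False
  then obtain m where n: "n = - int (Suc m)" by (metis negD not_le)
  \<comment> \<open>The sign exponent \<open>m\<close> is one less than that from
    \<open>powi_minus_conjugate\<close>; the extra sign undoes the exchange of \<open>alpha\<close>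
    and \<open>beta\<close>.\<close>
  have "sqrt 5 * Fib n = (-1) ^ m * (sqrt 5 * real_of_int (fibn (Suc m)))"
    unfolding n by (simp add: Fib_def nat_add_distrib del: fibn.simps)
  then show ?thesis
    unfolding fibn_binet n powi_minus_conjugate by (simp add: algebra_simps)
qed

lemma Luc_binet: "Luc n = alpha powi n + beta powi n"
proof (cases "n \<ge> 0")
  case True
  then show ?thesis
    using lucn_binet[of "nat n"] by (simp add: Luc_def power_int_def)
next
  case False
  then obtain m where n: "n = - int (Suc m)" by (metis negD not_le)
  show ?thesis
    using lucn_binet[of "Suc m"] unfolding n powi_minus_conjugate
    by (simp add: Luc_def nat_add_distrib algebra_simps del: lucn.simps)
qed

text \<open>In Binet's formula the powers with exponent p + q of one base cancel, and the p-th power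
  of the other base factors out. This produces the numerators of the logarithms.\<close>

lemma Fib_add_minus:
  "Fib (p + q) - alpha powi q * Fib p = beta powi p * Fib q"
  "Fib (p + q) - beta powi q * Fib p = alpha powi p * Fib q"
proof -
  have nz: "alpha \<noteq> 0" "beta \<noteq> 0" using alpha_gt beta_less_0 by auto
  have "sqrt 5 * (Fib (p + q) - alpha powi q * Fib p) = sqrt 5 * (beta powi p * Fib q)"
    using Fib_binet[of p] Fib_binet[of q] Fib_binet[of "p + q"] nz
    by (simp add: right_diff_distrib mult.left_commute[of "sqrt 5"] power_int_add)
  then show "Fib (p + q) - alpha powi q * Fib p = beta powi p * Fib q" by simp
  have "sqrt 5 * (Fib (p + q) - beta powi q * Fib p) = sqrt 5 * (alpha powi p * Fib q)"
    using Fib_binet[of p] Fib_binet[of q] Fib_binet[of "p + q"] nz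
    by (simp add: right_diff_distrib mult.left_commute[of "sqrt 5"] power_int_add)
  then show "Fib (p + q) - beta powi q * Fib p = alpha powi p * Fib q" by simp
qed

section \<open>Size of the Fibonacci ratios\<close>

lemma fibn_nonneg: "fibn n \<ge> 0"
  by (induction n rule: fibn.induct) auto

lemma fibn_pos: "n > 0 \<Longrightarrow> fibn n \<ge> 1"
proof (induction n rule: fibn.induct)
  case (3 n)
  then show ?case using fibn_nonneg[of n] by simp
qed auto

lemma fibn_Suc_le: "real_of_int (fibn (Suc n)) \<le> alpha ^ n"
proof (induction n rule: fibn.induct)
  case (3 n)
  then show ?case
    unfolding power_recurrence[OF alpha_square] by (simp del: power_Suc)
qed (use alpha_gt in auto)

text \<open>The upper bound only has to beat 3 - 2 * sqrt 2, the smaller root of 4 * a = (1 - a)^2.\<close>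

lemma Fib_ratio_bounds:
  fixes m n :: nat
  assumes "m \<ge> 2" "n \<ge> 1"
  defines "a \<equiv> real_of_int (fibn n) / (alpha ^ (m + n) * ((-1) ^ (m - 1) * real_of_int (fibn m)))"
  shows "-1 < a" "a < 1 / 6"
proof -
  \<comment> \<open>\<open>y\<close> is the absolute value of \<open>a\<close>; the parity of
    \<open>m\<close> decides the sign.\<close>
  define y where "y = real_of_int (fibn n) / (alpha ^ (m + n) * real_of_int (fibn m))"
  have al: "1 \<le> alpha" using alpha_gt by simp
  have fm: "real_of_int (fibn m) \<ge> 1" and fn: "real_of_int (fibn n) \<ge> 1"
    using fibn_pos[of m] fibn_pos[of n] assms(1,2) by auto
  have fn_le: "real_of_int (fibn n) \<le> alpha ^ (n - 1)"
    using fibn_Suc_le[of "n - 1"] assms(2) by simp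
  have y_less: "y < 1 / d" if d: "d > 0" "d < alpha ^ j" "j \<le> m + 1" for d j
  proof -
    have "d * real_of_int (fibn n) < alpha ^ j * real_of_int (fibn n)"
      using d fn by (intro mult_strict_right_mono) auto
    also have "\<dots> \<le> alpha ^ (m + 1) * alpha ^ (n - 1)"
      using d al fn fn_le by (intro mult_mono power_increasing) auto
    also have "\<dots> = alpha ^ (m + n)"
      unfolding power_add[symmetric] using assms(2) by simp
    also have "\<dots> \<le> alpha ^ (m + n) * real_of_int (fibn m)"
      using al fm by simp
    finally show ?thesis
      using d(1) al fm by (simp add: y_def field_simps)
  qed
  have y0: "y > 0" using al fn fm by (simp add: y_def)
  have y1: "y < 1" using y_less[of 1 1] alpha_gt by simp
  \<comment> \<open>For even \<open>m\<close>, \<open>a\<close> is negative and y < 1 suffices. For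
    odd \<open>m\<close>, m \<ge> 3 admits the exponent 4 in \<open>y_less\<close>, and alpha^4 >
    6.\<close>
  consider "even m" | "odd m" "m \<ge> 3"
    using assms(1) by (cases "m = 2") auto
  then have "-1 < a \<and> a < 1 / 6"
  proof cases
    case 1
    then have "a = - y" using assms(1) by (simp add: a_def y_def)
    then show ?thesis using y0 y1 by simp
  next
    case 2
    then have "a = y" by (simp add: a_def y_def)
    moreover have "1.6 ^ 4 < alpha ^ 4" using alpha_gt by (intro power_strict_mono) auto
    then have "6 < alpha ^ 4" by (simp add: power_divide)
    then have "y < 1 / 6" using y_less[of 6 4] 2 by simp
    ultimately show ?thesis using y0 by simp
  qed
  then show "-1 < a" "a < 1 / 6" by auto
qed

section \<open>The Fibonacci and Lucas series\<close>

theorem theorem9: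
  fixes p q :: int
  assumes "p \<le> -2" and "q \<ge> 4" and "q > \<bar>p\<bar> + 1"
  defines "z \<equiv> - 27 * Fib p * Fib (p + q) / (Fib q)\<^sup>2"
  defines "T1 \<equiv> arctan (sqrt 3 * cbrt (Fib (p + q))
                   / (2 * cbrt (alpha powi q * Fib p) + cbrt (Fib (p + q))))"
  defines "T2 \<equiv> arctan (sqrt 3 * cbrt (Fib p)
                   / (2 * (-1) powi q * cbrt (alpha powi q * Fib (p + q)) + cbrt (Fib p)))"
  defines "G1 \<equiv> ln (beta powi p * Fib q / (cbrt (Fib (p + q)) - cbrt (alpha powi q * Fib p)) ^ 3)"
  defines "G2 \<equiv> ln (alpha powi p * Fib q / (cbrt (Fib (p + q)) - cbrt (beta powi q * Fib p)) ^ 3)"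
  shows "((\<lambda>k. sqrt 5 / cbrt (Fib p * Fib (p + q)) *
              (z ^ (k + 1) * Fib ((2 * p + q) * int (k + 1))
               / (real (k + 1) * real ((3 * (k + 1)) choose (k + 1)))))
           sums (2 * sqrt 3 * (Aminus p q alpha * T1 + Aminus p q beta * T2)
                 - (Aplus p q alpha * G1 - Aplus p q beta * G2))) \<and>
         ((\<lambda>k. 1 / cbrt (Fib p * Fib (p + q)) *
              (z ^ (k + 1) * Luc ((2 * p + q) * int (k + 1))
               / (real (k + 1) * real ((3 * (k + 1)) choose (k + 1)))))
           sums (2 * sqrt 3 * (Aminus p q alpha * T1 - Aminus p q beta * T2)
                 - (Aplus p q alpha * G1 + Aplus p q beta * G2)))"
proof -
  define f v wa wb e where "f = cbrt (Fib p)" and "v = cbrt (Fib (p + q))"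
    and "wa = cbrt (alpha powi q)" and "wb = cbrt (beta powi q)" and "e = ((-1) powi q :: real)"
  define ua ub where "ua = wa * f" and "ub = wb * f"
  have cubes: "f ^ 3 = Fib p" "v ^ 3 = Fib (p + q)" "wa ^ 3 = alpha powi q" "wb ^ 3 = beta powi q"
    by (simp_all add: f_def v_def wa_def wb_def odd_real_root_pow)
  have u_cubes: "ua ^ 3 = alpha powi q * Fib p" "ub ^ 3 = beta powi q * Fib p"
    by (simp_all add: ua_def ub_def power_mult_distrib cubes)
  have u_cbrt: "cbrt (alpha powi q * Fib p) = ua" "cbrt (beta powi q * Fib p) = ub"
      "cbrt (alpha powi q * Fib (p + q)) = wa * v" "cbrt (Fib p * Fib (p + q)) = f * v"
    by (simp_all add: real_root_mult ua_def ub_def wa_def wb_def f_def v_def)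
  define m n where "m = nat (- p)" and "n = nat (p + q)"
  have mn: "m \<ge> 2" "n \<ge> 2" "p = - int m" "p + q = int n" "q = int (m + n)"
    using assms(1-3) by (auto simp: m_def n_def)
  have nz: "alpha \<noteq> 0" "beta \<noteq> 0" using alpha_gt beta_less_0 by auto
  have fibn_nz: "fibn m \<noteq> 0" "fibn n \<noteq> 0" "fibn (m + n) \<noteq> 0"
    using fibn_pos[of m] fibn_pos[of n] fibn_pos[of "m + n"] mn(1,2) by auto
  have Fib_p: "Fib p = (-1) ^ (m - 1) * real_of_int (fibn m)"
    using mn(1) unfolding mn(3) by (simp add: Fib_def)
  have Fib_pq: "Fib (p + q) = real_of_int (fibn n)" unfolding mn(4) by (simp add: Fib_def)
  have Fib_q: "Fib q \<noteq> 0" using fibn_nz(3) unfolding mn(5) by (simp add: Fib_def nat_add_distrib)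
  have uv_nz: "v \<noteq> 0" "f \<noteq> 0" "wa \<noteq> 0" "wb \<noteq> 0" "ua \<noteq> 0" "ub \<noteq> 0"
    using fibn_nz nz by (simp_all add: f_def v_def wa_def wb_def ua_def ub_def Fib_p Fib_pq)
  \<comment> \<open>The real cube root fixes 1 and -1.\<close>
  have w_mult: "wa * wb = e"
  proof -
    have "wa * wb = cbrt ((-1) powi q)"
      by (simp add: wa_def wb_def real_root_mult[symmetric] power_int_mult_distrib[symmetric] alpha_mult_beta)
    also have "\<dots> = (-1) powi q"
      unfolding mn(5) power_int_of_nat by (cases "even (m + n)") (auto simp: real_root_minus)
    finally show ?thesis by (simp add: e_def)
  qed
  have e: "e * e = 1"
    by (simp add: e_def power_int_mult_distrib[symmetric])
  have diffs: "v ^ 3 - ua ^ 3 = beta powi p * Fib q" "v ^ 3 - ub ^ 3 = alpha powi p * Fib q"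
    using Fib_add_minus[of p q] by (simp_all add: u_cubes cubes)

  define d where "d k = real (k + 1) * real ((3 * (k + 1)) choose (k + 1))" for k
  \<comment> \<open>\<open>X alpha\<close> and \<open>X beta\<close> are the arguments of the two
    power series into which Binet's formulas split both sums.\<close>
  define X where "X s = z * s powi (2 * p + q)" for s
  \<comment> \<open>The values from \<open>sums_inverse_choose_cubes\<close> for the pairs
    \<open>v\<close>, \<open>ua\<close> and \<open>ub\<close>, \<open>v\<close>. The order differs
    because the first entry must have the suitably smaller cube: \<open>alpha powi q\<close> is
    large, \<open>beta powi q\<close> small.\<close>
  define Sa where "Sa = 2 * sqrt 3 * (v * ua * (ua - v) / (v ^ 3 + ua ^ 3)) * arctan (sqrt 3 * v / (2 * ua + v))
       - v * ua * (v + ua) / (v ^ 3 + ua ^ 3) * ln ((ua ^ 3 - v ^ 3) / (ua - v) ^ 3)"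
  define Sb where "Sb = 2 * sqrt 3 * (ub * v * (v - ub) / (ub ^ 3 + v ^ 3)) * arctan (sqrt 3 * ub / (2 * v + ub))
       - ub * v * (ub + v) / (ub ^ 3 + v ^ 3) * ln ((v ^ 3 - ub ^ 3) / (v - ub) ^ 3)"
  \<comment> \<open>As s t = -1, s^(2p) = 1 / t^(2p); the denominator then becomes the square of a
    difference of cubes via \<open>diffs\<close>.\<close>
  have parameter: "X s = - 27 * (s powi q * Fib p) * Fib (p + q) / (t powi p * Fib q)\<^sup>2"
    if st: "s * t = -1" for s t
  proof -
    have "s \<noteq> 0" "t \<noteq> 0" using st by auto
    have "(s powi p * t powi p)\<^sup>2 = 1"
      unfolding power_int_mult_distrib[symmetric] st mn(3) by (cases "even m") (auto simp: power_int_minus)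
    then have "s powi p * s powi p = 1 / (t powi p)\<^sup>2"
      using \<open>t \<noteq> 0\<close> by (simp add: power2_eq_square field_simps)
    moreover have "s powi (2 * p + q) = (s powi p * s powi p) * s powi q"
      unfolding mult_2 by (simp only: power_int_add[OF disjI1[OF \<open>s \<noteq> 0\<close>]])
    ultimately show ?thesis
      by (simp add: X_def z_def power_mult_distrib mult_ac)
  qed
  have Sa_sums: "(\<lambda>k. X alpha ^ (k + 1) / d k) sums Sa"
  proof -
    have "v ^ 3 / ua ^ 3 = real_of_int (fibn n) / (alpha ^ (m + n) * ((-1) ^ (m - 1) * real_of_int (fibn m)))"
      unfolding cubes u_cubes Fib_p Fib_pq by (simp only: mn(5) power_int_of_nat)
    then have "-1 < v ^ 3 / ua ^ 3" "v ^ 3 / ua ^ 3 < 1 / 6"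
      using Fib_ratio_bounds[of m n] mn(1,2) by simp_all
    then have "(\<lambda>k. (- 27 * v ^ 3 * ua ^ 3 / (ua ^ 3 - v ^ 3)\<^sup>2) ^ (k + 1) / d k) sums Sa"
      unfolding Sa_def d_def using uv_nz by (intro sums_inverse_choose_cubes)
    moreover have "- 27 * v ^ 3 * ua ^ 3 / (ua ^ 3 - v ^ 3)\<^sup>2 = X alpha"
      unfolding parameter[OF alpha_mult_beta] diffs(1)[symmetric] power2_commute[of "ua ^ 3"]
      by (simp add: cubes u_cubes mult_ac)
    ultimately show ?thesis by (simp only:)
  qed
  have Sb_sums: "(\<lambda>k. X beta ^ (k + 1) / d k) sums Sb"
  proof -
    \<comment> \<open>Trading \<open>beta\<close> for \<open>alpha\<close> turns the ratio into that
      of \<open>Fib_ratio_bounds\<close> with \<open>m\<close> and \<open>n\<close>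
      exchanged.\<close>
    have "beta ^ (m + n) * alpha ^ (m + n) = (-1) ^ (m + n)"
      by (simp only: power_mult_distrib[symmetric] mult.commute[of beta] alpha_mult_beta)
    then have "beta ^ (m + n) = (-1) ^ (m + n) / alpha ^ (m + n)"
      using nz by (simp add: field_simps)
    moreover have "(-1) ^ (m + n) * (-1) ^ (m - 1) = (1 / (-1) ^ (n - 1) :: real)"
      using mn(1,2) by (cases "even m"; cases "even n") auto
    moreover have "ub ^ 3 / v ^ 3 = beta ^ (m + n) * ((-1) ^ (m - 1) * real_of_int (fibn m)) / real_of_int (fibn n)"
      unfolding cubes u_cubes Fib_p Fib_pq by (simp only: mn(5) power_int_of_nat)
    ultimately have "ub ^ 3 / v ^ 3 = real_of_int (fibn m) / (alpha ^ (n + m) * ((-1) ^ (n - 1) * real_of_int (fibn n)))"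
      by (simp add: mult.assoc[symmetric] add.commute)
    then have "-1 < ub ^ 3 / v ^ 3" "ub ^ 3 / v ^ 3 < 1 / 6"
      using Fib_ratio_bounds[of n m] mn(1,2) by simp_all
    then have "(\<lambda>k. (- 27 * ub ^ 3 * v ^ 3 / (v ^ 3 - ub ^ 3)\<^sup>2) ^ (k + 1) / d k) sums Sb"
      unfolding Sb_def d_def using uv_nz by (intro sums_inverse_choose_cubes)
    moreover have "- 27 * ub ^ 3 * v ^ 3 / (v ^ 3 - ub ^ 3)\<^sup>2 = X beta"
      unfolding parameter[of beta alpha, unfolded mult.commute[of beta], OF alpha_mult_beta] diffs(2)[symmetric]
      by (simp add: cubes u_cubes)
    ultimately show ?thesis by (simp only:)
  qed
  have A_eq: "Aminus p q alpha = wa * (ua - v) / (ua ^ 3 + v ^ 3)" "Aplus p q alpha = wa * (ua + v) / (ua ^ 3 + v ^ 3)"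
      "Aminus p q beta = wb * (ub - v) / (ub ^ 3 + v ^ 3)" "Aplus p q beta = wb * (ub + v) / (ub ^ 3 + v ^ 3)"
    by (simp_all only: Aminus_def Aplus_def u_cbrt v_def[symmetric] wa_def[symmetric] wb_def[symmetric] u_cubes cubes)
  have Sa_value: "Sa / (f * v) = 2 * sqrt 3 * (Aminus p q alpha * T1) - Aplus p q alpha * G1"
  proof -
    \<comment> \<open>Numerator and denominator both change sign, as the cube is odd.\<close>
    have "(ua ^ 3 - v ^ 3) / (ua - v) ^ 3 = - (v ^ 3 - ua ^ 3) / (- (v - ua)) ^ 3"
      by simp
    also have "\<dots> = (v ^ 3 - ua ^ 3) / (v - ua) ^ 3"
      by (subst power_minus_odd) (simp, rule minus_divide_divide)
    finally have "ln ((ua ^ 3 - v ^ 3) / (ua - v) ^ 3) = G1"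
      by (simp add: G1_def u_cbrt v_def[symmetric] diffs)
    moreover have "arctan (sqrt 3 * v / (2 * ua + v)) = T1"
      by (simp add: T1_def u_cbrt v_def[symmetric])
    moreover have "v * ua * (ua - v) / (v ^ 3 + ua ^ 3) = f * v * Aminus p q alpha"
      unfolding A_eq
      by (simp add: ua_def mult_ac add.commute)
    moreover have "v * ua * (v + ua) / (v ^ 3 + ua ^ 3) = f * v * Aplus p q alpha"
      unfolding A_eq
      by (simp add: ua_def mult_ac add.commute)
    ultimately have "Sa = f * v * (2 * sqrt 3 * (Aminus p q alpha * T1) - Aplus p q alpha * G1)"
      unfolding Sa_def by (simp add: algebra_simps)
    then show ?thesis using uv_nz by simp
  qed
  have Sb_value: "Sb / (f * v) = - (2 * sqrt 3 * (Aminus p q beta * T2)) - Aplus p q beta * G2"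
  proof -
    have "ln ((v ^ 3 - ub ^ 3) / (v - ub) ^ 3) = G2"
      by (simp add: G2_def u_cbrt v_def[symmetric] diffs)
    moreover have "arctan (sqrt 3 * ub / (2 * v + ub)) = T2"
    proof -
      \<comment> \<open>Expanding the fraction by \<open>wb\<close> uses \<open>wa * wb = e\<close>
        and \<open>e * e = 1\<close>; this explains the factor (-1)^q in the theorem.\<close>
      have "sqrt 3 * f / (2 * e * (wa * v) + f) = (wb * (sqrt 3 * f)) / (wb * (2 * e * (wa * v) + f))"
        using uv_nz by simp
      also have "wb * (2 * e * (wa * v) + f) = 2 * (e * (wa * wb)) * v + ub"
        by (simp add: ub_def algebra_simps)
      also have "\<dots> = 2 * v + ub" unfolding w_mult e by simp
      finally show ?thesis
        by (simp add: T2_def u_cbrt f_def[symmetric] e_def[symmetric] ub_def mult_ac)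
    qed
    \<comment> \<open>\<open>Aminus\<close> contains \<open>ub - v\<close> instead of
      \<open>v - ub\<close>, hence the opposite sign of the second arctangent term.\<close>
    moreover have "ub * v * (v - ub) / (ub ^ 3 + v ^ 3) = - (f * v * Aminus p q beta)"
    proof -
      have "ub * v * (v - ub) = - (f * v * (wb * (ub - v)))" by (simp add: ub_def algebra_simps)
      then show ?thesis unfolding A_eq by (simp only: times_divide_eq_right minus_divide_left)
    qed
    moreover have "ub * v * (ub + v) / (ub ^ 3 + v ^ 3) = f * v * Aplus p q beta"
      unfolding A_eq
      by (simp add: ub_def mult_ac)
    ultimately have "Sb = f * v * (- (2 * sqrt 3 * (Aminus p q beta * T2)) - Aplus p q beta * G2)"
      unfolding Sb_def by (simp add: algebra_simps)
    then show ?thesis using uv_nz by simp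
  qed
  have X_power: "X s ^ (k + 1) = z ^ (k + 1) * s powi ((2 * p + q) * int (k + 1))" for s k
    by (simp only: X_def power_mult_distrib power_int_mult power_int_of_nat)
  \<comment> \<open>By Binet, the difference of the two series gives sqrt 5 times the Fibonacci
    numbers, and their sum gives the Lucas numbers.\<close>
  have "(\<lambda>k. X alpha ^ (k + 1) / d k / (f * v) - X beta ^ (k + 1) / d k / (f * v)) sums (Sa / (f * v) - Sb / (f * v))"
    by (intro sums_diff sums_divide Sa_sums Sb_sums)
  moreover have "X alpha ^ (k + 1) / d k / (f * v) - X beta ^ (k + 1) / d k / (f * v) =
      sqrt 5 / cbrt (Fib p * Fib (p + q)) * (z ^ (k + 1) * Fib ((2 * p + q) * int (k + 1)) / d k)" for k
  proof -
    have "X alpha ^ (k + 1) - X beta ^ (k + 1) = sqrt 5 * (z ^ (k + 1) * Fib ((2 * p + q) * int (k + 1)))"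
      unfolding X_power right_diff_distrib[symmetric] Fib_binet[symmetric] by (rule mult.left_commute)
    then show ?thesis
      unfolding diff_divide_distrib[symmetric] u_cbrt by (simp del: power_Suc)
  qed
  moreover have "(\<lambda>k. X alpha ^ (k + 1) / d k / (f * v) + X beta ^ (k + 1) / d k / (f * v)) sums (Sa / (f * v) + Sb / (f * v))"
    by (intro sums_add sums_divide Sa_sums Sb_sums)
  moreover have "X alpha ^ (k + 1) / d k / (f * v) + X beta ^ (k + 1) / d k / (f * v) =
      1 / cbrt (Fib p * Fib (p + q)) * (z ^ (k + 1) * Luc ((2 * p + q) * int (k + 1)) / d k)" for k
  proof -
    have "X alpha ^ (k + 1) + X beta ^ (k + 1) = z ^ (k + 1) * Luc ((2 * p + q) * int (k + 1))"
      unfolding X_power distrib_left[symmetric] Luc_binet by (rule refl)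
    then show ?thesis
      unfolding add_divide_distrib[symmetric] u_cbrt by (simp del: power_Suc)
  qed
  moreover have "Sa / (f * v) - Sb / (f * v) = 2 * sqrt 3 * (Aminus p q alpha * T1 + Aminus p q beta * T2)
                 - (Aplus p q alpha * G1 - Aplus p q beta * G2)"
    "Sa / (f * v) + Sb / (f * v) = 2 * sqrt 3 * (Aminus p q alpha * T1 - Aminus p q beta * T2)
                 - (Aplus p q alpha * G1 + Aplus p q beta * G2)"
    unfolding Sa_value Sb_value by (simp_all add: algebra_simps)
  ultimately show ?thesis unfolding d_def by (simp only: simp_thms)
qed

end
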